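(* Let $\mathbb{F}_q$ be a finite field with $q$ elements, $n\ge 1$, $a_1,\dots,a_n\in\mathbb{F}_q^*$ and $b\in\mathbb{F}_q$. Let $$f(x_1,\dots,x_n)=\sum_{j=1}^n a_j x_1^{d_{1,j}}\cdots x_j^{d_{j,j}}-b\in\mathbb{F}_q[x_1,\dots,x_n]$$ be a fully triangular polynomial (that is, $d_{i,j}>0$ for all $1\le i\le j\le n$) that is totally $*$-equivalent to the linear polynomial $g(x_1,\dots,x_n)=a_1x_1+\dots+a_nx_n-b$. Then the number $N(f)$ of roots of $f$ in $\mathbb{F}_q^n$ is $$N(f)=\begin{cases}\dfrac{q^n-(-1)^n}{q+1}, & \text{if } b\ne 0,\\[2mm] \dfrac{2q^n+(-1)^n(q-1)}{q+1}, & \text{if } b=0.\end{cases}$$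
   Context: For a polynomial $f=\sum_{j=1}^m a_jX^{D_j}\in\mathbb{F}_q[x_1,\dots,x_n]$ with all $a_j\neq 0$, $D_j=(d_{1j},\dots,d_{nj})\in\mathbb{Z}_{\ge0}^n$ and $X^{D_j}=x_1^{d_{1j}}\cdots x_n^{d_{nj}}$, the augmented degree matrix $\tilde D_f$ is the $(n+1)\times m$ matrix whose $j$-th column is $(1,d_{1j},\dots,d_{nj})^T$. The vector $(a_1,\dots,a_m)$ is the coefficient vector. A triangular polynomial is one of the form $\sum_{j=1}^n a_jX^{D_j}-b$ with $a_1,\dots,a_n\in\mathbb{F}_q^*$, $b\in\mathbb{F}_q$, $D_j=(d_{1,j},\dots,d_{j,j},0,\dots,0)$, $d_{j,j}>0$ for all $j$ and $d_{i,j}\ge 0$ for $i<j$. Its monomials are ordered $X^{D_1},\dots,X^{D_n}$, followed, only if $b\ne0$, by the constant term with coefficient $-b$ and column $(1,0,\dots,0)^T$. Two polynomials $f,g$ are $*$-equivalent if they have the same coefficient vector and the congruence systems $\tilde D_f v^T\equiv 0\pmod{q-1}$ and $\tilde D_g v^T\equiv 0\pmod{q-1}$ have the same set of solutions $v$. For $1\le k\le n$ let $f_k(x_1,\dots,x_k)=f(x_1,\dots,x_k,0,\dots,0)\in\mathbb{F}_q[x_1,\dots,x_k]$. Polynomials $f,g\in\mathbb{F}_q[x_1,\dots,x_n]$ are totally $*$-equivalent if $f_k$ is $*$-equivalent to $g_k$ for all $1\le k\le n$. *)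

theory Defs
  imports "Jordan_Normal_Form.Matrix" "HOL-Number_Theory.Cong" "HOL-Library.Cardinality"
begin

text \<open>
  Coefficient vectors and degree matrices depend on the order of the monomials, so a polynomial in
  \<open>n\<close> variables is given by the ordered list of its terms \<open>a * X^D\<close>, each represented by the pair
  of its coefficient \<open>a\<close> and its exponent vector \<open>D\<close> of dimension \<open>n\<close>. The intended lists have
  nonzero coefficients and pairwise distinct exponent vectors.
  Indices start at 0: the variable \<open>x_(i+1)\<close> has index \<open>i\<close>.
\<close>

type_synonym 'a terms = "('a \<times> nat vec) list"

definition eval_terms :: "'a::comm_semiring_1 terms \<Rightarrow> 'a vec \<Rightarrow> 'a" where
  "eval_terms f x = (\<Sum>(a, D)\<leftarrow>f. a * (\<Prod>i<dim_vec D. (x $ i) ^ (D $ i)))"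

definition roots_in :: "nat \<Rightarrow> 'a::comm_semiring_1 terms \<Rightarrow> 'a vec set" where
  "roots_in n f = {x \<in> carrier_vec n. eval_terms f x = 0}"

definition coeff_vector :: "'a terms \<Rightarrow> 'a list" where
  "coeff_vector f = map fst f"

definition aug_degree_mat :: "nat \<Rightarrow> 'a terms \<Rightarrow> int mat" where
  "aug_degree_mat n f = mat_of_cols (n + 1) (map (\<lambda>(a, D). vCons 1 (map_vec int D)) f)"

definition cong_solutions :: "int \<Rightarrow> int mat \<Rightarrow> int vec set" where
  "cong_solutions m A =
     {v \<in> carrier_vec (dim_col A). \<forall>i<dim_row A. [(A *\<^sub>v v) $ i = 0] (mod m)}"

text \<open>The field with \<open>q\<close> elements is the coefficient type, so \<open>q\<close> is \<open>CARD('a)\<close>.\<close>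

definition star_equiv :: "nat \<Rightarrow> 'a::{finite,field} terms \<Rightarrow> 'a terms \<Rightarrow> bool" where
  "star_equiv n f g \<longleftrightarrow>
     coeff_vector f = coeff_vector g \<and>
     cong_solutions (int CARD('a) - 1) (aug_degree_mat n f) =
     cong_solutions (int CARD('a) - 1) (aug_degree_mat n g)"

text \<open>
  Setting the variables with index at least \<open>k\<close> to 0 removes exactly the terms in which one of
  them occurs; the remaining terms are regarded as terms in \<open>k\<close> variables.
\<close>

definition restrict_vars :: "nat \<Rightarrow> 'a terms \<Rightarrow> 'a terms" where
  "restrict_vars k f =
     [(a, vec_first D k). (a, D) \<leftarrow> f, \<forall>i. k \<le> i \<and> i < dim_vec D \<longrightarrow> D $ i = 0]"

lemma eval_restrict_vars:
  fixes f :: "'a::comm_semiring_1 terms"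
  assumes "\<forall>(a, D)\<in>set f. dim_vec D = n" "k \<le> n" "x \<in> carrier_vec k"
  shows "eval_terms (restrict_vars k f) x = eval_terms f (x @\<^sub>v 0\<^sub>v (n - k))"
  using assms(1)
proof (induction f)
  case Nil
  then show ?case by (simp add: eval_terms_def restrict_vars_def)
next
  case (Cons t f)
  obtain a D where t: "t = (a, D)" by (cases t)
  let ?y = "x @\<^sub>v 0\<^sub>v (n - k)"
  have D: "dim_vec D = n" using Cons.prems t by auto
  have split: "(\<Prod>i<n. (?y $ i) ^ (D $ i)) =
      (\<Prod>i<k. (x $ i) ^ (D $ i)) * (\<Prod>i\<in>{k..<n}. 0 ^ (D $ i))"
  proof -
    have "{..<n} = {..<k} \<union> {k..<n}" using assms(2) by auto
    then have "(\<Prod>i<n. (?y $ i) ^ (D $ i)) =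
        (\<Prod>i<k. (?y $ i) ^ (D $ i)) * (\<Prod>i\<in>{k..<n}. (?y $ i) ^ (D $ i))"
      by (simp add: prod.union_disjoint ivl_disj_int)
    moreover have "(\<Prod>i<k. (?y $ i) ^ (D $ i)) = (\<Prod>i<k. (x $ i) ^ (D $ i))"
      using assms by (intro prod.cong) auto
    moreover have "(\<Prod>i\<in>{k..<n}. (?y $ i) ^ (D $ i)) = (\<Prod>i\<in>{k..<n}. 0 ^ (D $ i))"
      using assms by (intro prod.cong) auto
    ultimately show ?thesis by simp
  qed
  have IH: "eval_terms (restrict_vars k f) x = eval_terms f ?y"
    using Cons by auto
  show ?case
  proof (cases "\<forall>i. k \<le> i \<and> i < n \<longrightarrow> D $ i = 0")
    case True
    then have "(\<Prod>i\<in>{k..<n}. (0::'a) ^ (D $ i)) = 1" by (intro prod.neutral) auto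
    moreover have "(\<Prod>i<k. (x $ i) ^ (vec_first D k $ i)) = (\<Prod>i<k. (x $ i) ^ (D $ i))"
      by (intro prod.cong) (auto simp: vec_first_def)
    ultimately show ?thesis
      using IH True D split by (simp add: t eval_terms_def restrict_vars_def)
  next
    case False
    then have "(\<Prod>i\<in>{k..<n}. (0::'a) ^ (D $ i)) = 0"
      by (intro prod_zero) (auto intro!: bexI simp: zero_power)
    then show ?thesis
      using IH False D split by (auto simp: t eval_terms_def restrict_vars_def)
  qed
qed

definition totally_star_equiv :: "nat \<Rightarrow> 'a::{finite,field} terms \<Rightarrow> 'a terms \<Rightarrow> bool" where
  "totally_star_equiv n f g \<longleftrightarrow>
     (\<forall>k. 1 \<le> k \<and> k \<le> n \<longrightarrow> star_equiv k (restrict_vars k f) (restrict_vars k g))"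

definition minus_const :: "nat \<Rightarrow> 'a::ring terms \<Rightarrow> 'a \<Rightarrow> 'a terms" where
  "minus_const n f b = f @ (if b = 0 then [] else [(- b, 0\<^sub>v n)])"

definition triangular_poly ::
  "nat \<Rightarrow> (nat \<Rightarrow> 'a::ring) \<Rightarrow> (nat \<Rightarrow> nat \<Rightarrow> nat) \<Rightarrow> 'a \<Rightarrow> 'a terms" where
  "triangular_poly n a d b =
     minus_const n (map (\<lambda>j. (a j, vec n (\<lambda>i. if i \<le> j then d i j else 0))) [0..<n]) b"

definition linear_poly :: "nat \<Rightarrow> (nat \<Rightarrow> 'a::ring) \<Rightarrow> 'a \<Rightarrow> 'a terms" where
  "linear_poly n a b = minus_const n (map (\<lambda>j. (a j, unit_vec n j)) [0..<n]) b"

end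

theory Submission
  imports Defs Complex_Main "HOL-Algebra.Multiplicative_Group" "Jordan_Normal_Form.VS_Connect"
begin

text \<open>
  Let \<open>N = q - 1\<close>. If the congruence system modulo \<open>N\<close> of the augmented degree matrix of a polynomial
  with \<open>m\<close> terms in \<open>k\<close> variables has only the trivial solution, then, by orthogonality of the
  characters of the cyclic group \<open>F\<^sup>*\<close>, the map \<open>(t, x) \<mapsto> (t X\<^bsup>D\<^sub>1\<^esup>, \<dots>, t X\<^bsup>D\<^sub>m\<^esup>)\<close> from \<open>(F\<^sup>*)\<^bsup>k+1\<^esup>\<close> to \<open>(F\<^sup>*)\<^sup>m\<close>
  has fibres of constant size. Since the common factor \<open>t\<close> does not affect vanishing, the number of
  roots with nonzero coordinates is, up to a power of \<open>N\<close>, the number of solutions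
  \<open>y \<in> (F\<^sup>*)\<^sup>m\<close> of \<open>a\<^sub>1 y\<^sub>1 + \<dots> + a\<^sub>m y\<^sub>m = 0\<close>, as for the linear polynomial. The remaining roots
  are counted recursively: a zero among the first \<open>k + 1\<close> coordinates kills the \<open>(k + 1)\<close>-st term of
  a fully triangular polynomial, so \<open>P\<^sub>k\<^sub>+\<^sub>1 = q P\<^sub>k + L\<^sub>k\<close>, where \<open>L\<^sub>k\<close> and \<open>P\<^sub>k\<close> count the roots of
  \<open>f\<^sub>k\<close> without and with zero coordinates.
\<close>

section \<open>Characters of the multiplicative group of a finite field\<close>

lemma power_mod_period:
  fixes x :: "'a::monoid_mult"
  assumes "x ^ p = 1"
  shows "x ^ (i mod p) = x ^ i"
proof -
  have "x ^ i = x ^ (p * (i div p) + i mod p)" by simp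
  also have "\<dots> = x ^ (i mod p)"
    unfolding power_add power_mult assms by simp
  finally show ?thesis by simp
qed

text \<open>The multiplicative group is cyclic. If \<open>p\<close> is the order of a generator, the
  powers with exponents below \<open>p\<close> run through the group without repetition, and
  counting them gives \<open>p = q - 1\<close>.\<close>

lemma finite_field_generator:
  obtains g :: "'a::{finite,field}"
  where "g \<noteq> 0" "g ^ (CARD('a) - 1) = 1" "bij_betw (\<lambda>i. g ^ i) {..<CARD('a) - 1} (- {0})"
proof -
  obtain g :: 'a where g: "g \<noteq> 0" "- {0} = range (\<lambda>i::nat. g ^ i)"
    using field.finite_field_mult_group_has_gen[OF class_field[where 'a = 'a]]
    by (auto simp: class_ring_simps carrier_mult_of full_SetCompr_eq Compl_eq_Diff_UNIV)
  let ?N = "CARD('a) - 1"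
  have card: "card (- {0::'a}) = ?N"
    by (simp add: Compl_eq_Diff_UNIV)
  obtain i j where ij: "i < j" "g ^ i = g ^ j"
  proof -
    have "\<not> inj (\<lambda>i::nat. g ^ i)"
      using finite_imageD infinite_UNIV_nat finite by blast
    then show ?thesis using that unfolding inj_def by (metis linorder_neqE_nat)
  qed
  have "\<exists>p>0. g ^ p = 1"
    using ij g(1) by (intro exI[of _ "j - i"]) (simp add: power_diff)
  \<comment> \<open>The multiplicative order of \<open>g\<close>; a period exists because the powers
    of \<open>g\<close> repeat.\<close>
  define p where "p = (LEAST p. p > 0 \<and> g ^ p = 1)"
  have p: "p > 0" "g ^ p = 1"
    using LeastI_ex[OF \<open>\<exists>p>0. g ^ p = 1\<close>] by (auto simp: p_def)
  have p_least: "g ^ r \<noteq> 1" if "0 < r" "r < p" for r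
    using not_less_Least[of r "\<lambda>p. p > 0 \<and> g ^ p = 1"] that by (auto simp: p_def)
  have "g ^ i = g ^ (i mod p)" for i
    using power_mod_period[OF p(2)] by simp
  then have "- {0} = (\<lambda>i. g ^ i) ` {..<p}"
    using g(2) p(1) by (auto simp: image_iff) (metis lessThan_iff mod_less_divisor)
  moreover have "inj_on (\<lambda>i. g ^ i) {..<p}"
  proof (rule linorder_inj_onI)
    fix i j assume "i < j" "i \<in> {..<p}" "j \<in> {..<p}"
    then have "g ^ (j - i) \<noteq> 1" by (intro p_least) auto
    then show "g ^ i \<noteq> g ^ j" using \<open>i < j\<close> g(1) by (auto simp: power_diff)
  qed auto
  ultimately have "bij_betw (\<lambda>i. g ^ i) {..<p} (- {0})"
    by (simp add: bij_betw_def)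
  moreover from bij_betw_same_card[OF this] have "p = ?N"
    by (simp add: card)
  ultimately show ?thesis using that[of g] g(1) p(2) by simp
qed

text \<open>For a generator \<open>g\<close> and a primitive \<open>N\<close>-th root of unity
  \<open>\<zeta>\<close>, the map \<open>g ^ i \<mapsto> \<zeta> ^ i\<close> is a character whose
  powers with exponents below \<open>N\<close> are all the characters. The two sums are the
  orthogonality relations: one runs over the characters, the other over the group. Both are
  geometric sums over \<open>N\<close>-th roots of unity.\<close>

lemma finite_field_character:
  obtains \<chi> :: "'a::{finite,field} \<Rightarrow> complex"
  where "\<And>x y. x \<noteq> 0 \<Longrightarrow> y \<noteq> 0 \<Longrightarrow> \<chi> (x * y) = \<chi> x * \<chi> y"
    and "\<chi> 1 = 1"
    and "\<And>x y. x \<noteq> 0 \<Longrightarrow> y \<noteq> 0 \<Longrightarrow> (\<Sum>v<CARD('a) - 1. (\<chi> x / \<chi> y) ^ v)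
        = (if x = y then of_nat (CARD('a) - 1) else 0)"
    and "\<And>s. (\<Sum>x\<in>- {0}. \<chi> x ^ s) = (if CARD('a) - 1 dvd s then of_nat (CARD('a) - 1) else 0)"
proof -
  define N where "N = CARD('a) - 1"
  obtain g :: 'a where g: "g \<noteq> 0" and gN: "g ^ N = 1" and bij: "bij_betw (\<lambda>i. g ^ i) {..<N} (- {0})"
    using finite_field_generator unfolding N_def by blast
  have N: "N > 0"
    using bij by (cases N) (auto simp: bij_betw_def dest: arg_cong[of _ _ "\<lambda>A. 1 \<in> A"])
  define \<zeta> where "\<zeta> = cis (2 * pi / N)"
  have zN: "\<zeta> ^ N = 1"
    using N by (simp add: \<zeta>_def DeMoivre)
  have zinj: "i = j" if "\<zeta> ^ i = \<zeta> ^ j" "i < N" "j < N" for i j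
  proof -
    have "\<zeta> ^ k = cis (2 * pi * k / N)" for k
      by (simp add: \<zeta>_def DeMoivre mult_ac)
    with that show ?thesis
      using inj_onD[OF bij_betw_imp_inj_on[OF bij_betw_roots_unity[OF N]], of i j] by simp
  qed
  have z1: "\<zeta> ^ i = 1 \<longleftrightarrow> N dvd i" for i
  proof -
    have "\<zeta> ^ i = 1 \<longleftrightarrow> \<zeta> ^ (i mod N) = \<zeta> ^ 0"
      using power_mod_period[OF zN, of i] by simp
    also have "\<dots> \<longleftrightarrow> i mod N = 0"
      using zinj[of "i mod N" 0] N by (metis mod_less_divisor)
    finally show ?thesis by (simp add: dvd_eq_mod_eq_0)
  qed
  have gmod: "g ^ i = g ^ (i mod N)" for i
    using power_mod_period[OF gN] by simp
  have zmod: "\<zeta> ^ i = \<zeta> ^ (i mod N)" for i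
    using power_mod_period[OF zN] by simp
  \<comment> \<open>The discrete logarithm to base \<open>g\<close>.\<close>
  define l where "l = the_inv_into {..<N} (\<lambda>i. g ^ i)"
  define \<chi> where "\<chi> = (\<lambda>x. \<zeta> ^ l x)"
  have l: "l x < N" "g ^ l x = x" if "x \<noteq> 0" for x
  proof -
    have "x \<in> (\<lambda>i. g ^ i) ` {..<N}" using bij that by (auto simp: bij_betw_def)
    then show "g ^ l x = x"
      unfolding l_def using bij by (intro f_the_inv_into_f) (auto simp: bij_betw_def)
    show "l x < N"
      unfolding l_def using the_inv_into_into[of "\<lambda>i. g ^ i" "{..<N}" x "{..<N}"]
        \<open>x \<in> _ ` _\<close> bij by (auto simp: bij_betw_def)
  qed
  have lg: "l (g ^ i) = i mod N" for i
  proof -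
    have "l (g ^ (i mod N)) = i mod N"
      unfolding l_def using bij N by (intro the_inv_into_f_f) (auto simp: bij_betw_def)
    then show ?thesis using gmod by metis
  qed
  have chi_g: "\<chi> (g ^ i) = \<zeta> ^ i" for i
    by (simp add: \<chi>_def lg zmod[symmetric])
  have nz: "\<zeta> \<noteq> 0" by (simp add: \<zeta>_def)
  have geom: "(\<Sum>v<N. w ^ v) = (if w = 1 then of_nat N else 0)" if "w ^ N = 1" for w :: complex
    using that by (simp add: sum_gp_strict)
  show ?thesis
  proof (rule that[of \<chi>])
    show mult: "\<chi> (x * y) = \<chi> x * \<chi> y" if "x \<noteq> 0" "y \<noteq> 0" for x y
      using that chi_g[of "l x + l y"] by (simp add: power_add l \<chi>_def)
    show one: "\<chi> 1 = 1" using chi_g[of 0] by simp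
    show "(\<Sum>v<CARD('a) - 1. (\<chi> x / \<chi> y) ^ v) = (if x = y then of_nat (CARD('a) - 1) else 0)"
      if xy: "x \<noteq> 0" "y \<noteq> 0" for x y
    proof -
      have pow: "\<chi> x ^ N = 1" for x
        unfolding \<chi>_def by (metis power_mult mult.commute zN power_one)
      have "x = y" if "\<chi> x = \<chi> y"
        using that zinj[of "l x" "l y"] l xy unfolding \<chi>_def by metis
      moreover have "\<chi> y \<noteq> 0" using nz by (simp add: \<chi>_def)
      ultimately show ?thesis
        using geom[of "\<chi> x / \<chi> y"] unfolding N_def[symmetric]
        by (auto simp: power_divide pow)
    qed
    show "(\<Sum>x\<in>- {0}. \<chi> x ^ s) = (if CARD('a) - 1 dvd s then of_nat (CARD('a) - 1) else 0)" for s
    proof -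
      have "(\<Sum>x\<in>- {0}. \<chi> x ^ s) = (\<Sum>i<N. (\<zeta> ^ s) ^ i)"
        by (subst sum.reindex_bij_betw[OF bij, symmetric])
          (simp add: chi_g flip: power_mult add: mult.commute)
      also have "\<dots> = (if N dvd s then of_nat N else 0)"
        by (subst geom) (simp_all add: z1 flip: power_mult)
      finally show ?thesis by (simp add: N_def)
    qed
  qed
qed

section \<open>Fibres of monomial maps on the torus\<close>

text \<open>The first orthogonality relation, applied in each of the \<open>m\<close> coordinates,
  writes \<open>N ^ m\<close> times the indicator of the fibre as a sum of characters indexed by
  exponent vectors \<open>v\<close> with entries below \<open>N\<close>. Summed over
  \<open>t\<close> and \<open>x\<close>, the term of \<open>v\<close> vanishes unless
  \<open>v\<close> solves the congruence system. By \<open>ker\<close> only \<open>v = 0\<close>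
  survives, and it contributes \<open>N\<close> for each of the \<open>k + 1\<close> coordinates.
  The factor \<open>t\<close> accounts for the row of ones in the augmented degree matrix.\<close>

lemma card_monomial_fibre:
  fixes D :: "nat \<Rightarrow> nat \<Rightarrow> nat" and y :: "nat \<Rightarrow> 'a::{finite,field}" and k m :: nat
  defines "N \<equiv> CARD('a) - 1"
  assumes ker: "\<And>v j. \<lbrakk>N dvd (\<Sum>j<m. v j); \<And>i. i < k \<Longrightarrow> N dvd (\<Sum>j<m. D i j * v j); j < m\<rbrakk>
      \<Longrightarrow> N dvd v j"
    and y: "y \<in> {..<m} \<rightarrow>\<^sub>E - {0}"
  shows "card {(t, x). t \<noteq> 0 \<and> x \<in> {..<k} \<rightarrow>\<^sub>E - {0} \<and> (\<forall>j<m. t * (\<Prod>i<k. x i ^ D i j) = y j)} * N ^ m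
    = N ^ Suc k"
proof -
  obtain \<chi> :: "'a \<Rightarrow> complex"
    where mult: "\<And>x y. x \<noteq> 0 \<Longrightarrow> y \<noteq> 0 \<Longrightarrow> \<chi> (x * y) = \<chi> x * \<chi> y"
      and one: "\<chi> 1 = 1"
      and orth1: "\<And>x y. x \<noteq> 0 \<Longrightarrow> y \<noteq> 0 \<Longrightarrow>
        (\<Sum>v<N. (\<chi> x / \<chi> y) ^ v) = (if x = y then of_nat N else 0)"
      and orth2: "\<And>s. (\<Sum>x\<in>- {0}. \<chi> x ^ s) = (if N dvd s then of_nat N else 0)"
    using finite_field_character unfolding N_def by blast
  have N: "N > 0"
    using card_mono[of UNIV "{0, 1::'a}"] by (simp add: N_def)
  have pow: "\<chi> (x ^ e) = \<chi> x ^ e" if "x \<noteq> 0" for x e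
    using that by (induction e) (auto simp: one mult)
  have prod: "\<chi> (\<Prod>i<k. z i) = (\<Prod>i<k. \<chi> (z i))" if "\<And>i. i < k \<Longrightarrow> z i \<noteq> 0" for z :: "nat \<Rightarrow> 'a" and k
    using that by (induction k) (auto simp: one mult prod_zero_iff)
  define P where "P = {..<k} \<rightarrow>\<^sub>E - {0::'a}"
  define V where "V = {..<m} \<rightarrow>\<^sub>E {..<N}"
  define M where "M = (\<lambda>t (x :: nat \<Rightarrow> 'a) j. t * (\<Prod>i<k. x i ^ D i j))"
  \<comment> \<open>The zero exponent vector as an element of \<open>V\<close>, hence
    \<open>undefined\<close> outside \<open>{..<m}\<close>.\<close>
  define v0 where "v0 = (\<lambda>j\<in>{..<m}. 0::nat)"
  have finP: "finite P" and finV: "finite V"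
    by (auto simp: P_def V_def intro!: finite_PiE)
  have y0: "y j \<noteq> 0" if "j < m" for j
    using y that by (auto simp: PiE_iff)
  have M0: "M t x j \<noteq> 0" if "t \<noteq> 0" "x \<in> P" for t x j
    using that by (auto simp: M_def P_def PiE_iff)
  have "{(t, x). t \<noteq> 0 \<and> x \<in> P \<and> (\<forall>j<m. M t x j = y j)}
      = {p \<in> (- {0}) \<times> P. \<forall>j<m. M (fst p) (snd p) j = y j}" (is "?S = _")
    by auto
  then have "of_nat (card ?S * N ^ m)
      = (\<Sum>(t, x)\<in>(- {0}) \<times> P. if \<forall>j<m. M t x j = y j then of_nat (N ^ m) else 0 :: complex)"
    by (simp add: case_prod_beta sum.If_cases finP Int_def)
  also have "\<dots> = (\<Sum>(t, x)\<in>(- {0}) \<times> P. \<Prod>j<m. \<Sum>v<N. (\<chi> (M t x j) / \<chi> (y j)) ^ v)"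
  proof (rule sum.cong[OF refl])
    fix p assume "p \<in> (- {0::'a}) \<times> P"
    then obtain t x where p: "p = (t, x)" and tx: "t \<in> - {0}" "x \<in> P" by blast
    then have "(\<Prod>j<m. \<Sum>v<N. (\<chi> (M t x j) / \<chi> (y j)) ^ v)
        = (\<Prod>j<m. if M t x j = y j then of_nat N else 0)"
      by (intro prod.cong) (auto simp: orth1 M0 y0)
    also have "\<dots> = (if \<forall>j<m. M t x j = y j then of_nat (N ^ m) else 0)"
    proof (cases "\<forall>j<m. M t x j = y j")
      case False
      then show ?thesis by (auto intro!: prod_zero)
    qed simp
    finally show "(case p of (t, x) \<Rightarrow> if \<forall>j<m. M t x j = y j then of_nat (N ^ m) else 0)
        = (case p of (t, x) \<Rightarrow> \<Prod>j<m. \<Sum>v<N. (\<chi> (M t x j) / \<chi> (y j)) ^ v)"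
      by (simp only: p prod.case)
  qed
  \<comment> \<open>Multiplying out the product of sums means choosing one exponent
    \<open>v j\<close> for each \<open>j\<close>.\<close>
  also have "\<dots> = (\<Sum>(t, x)\<in>(- {0}) \<times> P. \<Sum>v\<in>V. \<Prod>j<m. (\<chi> (M t x j) / \<chi> (y j)) ^ v j)"
    by (simp add: prod_sum_PiE V_def)
  also have "\<dots> = (\<Sum>v\<in>V. \<Sum>(t, x)\<in>(- {0}) \<times> P. \<Prod>j<m. (\<chi> (M t x j) / \<chi> (y j)) ^ v j)"
    by (simp add: case_prod_beta) (rule sum.swap)
  also have "\<dots> = (\<Sum>v\<in>V. if v = v0 then of_nat (N ^ Suc k) else 0)"
  proof (intro sum.cong refl)
    fix v assume v: "v \<in> V"
    \<comment> \<open>Regrouped by variables, the exponents of \<open>\<chi> t\<close> and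
      \<open>\<chi> (x i)\<close> become the left-hand sides of the congruences for
      \<open>v\<close>, and the dependence on \<open>y\<close> splits off as a constant.\<close>
    have "(\<Prod>j<m. (\<chi> (M t x j) / \<chi> (y j)) ^ v j)
        = (\<Prod>j<m. (1 / \<chi> (y j)) ^ v j) * (\<chi> t ^ (\<Sum>j<m. v j) * (\<Prod>i<k. \<chi> (x i) ^ (\<Sum>j<m. D i j * v j)))"
      if tx: "t \<noteq> 0" "x \<in> P" for t x
    proof -
      have "\<chi> (M t x j) = \<chi> t * (\<Prod>i<k. \<chi> (x i) ^ D i j)" for j
        using tx by (auto simp: M_def mult prod pow P_def PiE_iff)
      then have "(\<Prod>j<m. \<chi> (M t x j) ^ v j)
          = (\<Prod>j<m. \<chi> t ^ v j) * (\<Prod>j<m. \<Prod>i<k. \<chi> (x i) ^ (D i j * v j))"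
        by (simp add: power_mult_distrib prod.distrib prod_power_distrib power_mult)
      also have "(\<Prod>j<m. \<Prod>i<k. \<chi> (x i) ^ (D i j * v j)) = (\<Prod>i<k. \<Prod>j<m. \<chi> (x i) ^ (D i j * v j))"
        by (rule prod.swap)
      finally show ?thesis
        by (simp add: power_sum power_divide prod_dividef)
    qed
    then have "(\<Sum>(t, x)\<in>(- {0}) \<times> P. \<Prod>j<m. (\<chi> (M t x j) / \<chi> (y j)) ^ v j)
        = (\<Sum>(t, x)\<in>(- {0}) \<times> P. (\<Prod>j<m. (1 / \<chi> (y j)) ^ v j) *
            (\<chi> t ^ (\<Sum>j<m. v j) * (\<Prod>i<k. \<chi> (x i) ^ (\<Sum>j<m. D i j * v j))))"
      by (intro sum.cong) auto
    also have "\<dots> = (\<Prod>j<m. (1 / \<chi> (y j)) ^ v j) * ((\<Sum>t\<in>- {0}. \<chi> t ^ (\<Sum>j<m. v j)) *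
          (\<Sum>x\<in>P. \<Prod>i<k. \<chi> (x i) ^ (\<Sum>j<m. D i j * v j)))"
      unfolding sum_product by (simp add: sum.cartesian_product sum_distrib_left case_prod_beta)
    also have "(\<Sum>x\<in>P. \<Prod>i<k. \<chi> (x i) ^ (\<Sum>j<m. D i j * v j))
        = (\<Prod>i<k. if N dvd (\<Sum>j<m. D i j * v j) then of_nat N else 0)"
      using prod_sum_PiE[of "{..<k}" "\<lambda>_. - {0}" "\<lambda>i u. \<chi> u ^ (\<Sum>j<m. D i j * v j)"]
      by (simp add: P_def orth2)
    finally have sum_eq: "(\<Sum>(t, x)\<in>(- {0}) \<times> P. \<Prod>j<m. (\<chi> (M t x j) / \<chi> (y j)) ^ v j)
        = (\<Prod>j<m. (1 / \<chi> (y j)) ^ v j) * ((if N dvd (\<Sum>j<m. v j) then of_nat N else 0) *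
           (\<Prod>i<k. if N dvd (\<Sum>j<m. D i j * v j) then of_nat N else 0))"
      by (simp add: orth2)
    show "(\<Sum>(t, x)\<in>(- {0}) \<times> P. \<Prod>j<m. (\<chi> (M t x j) / \<chi> (y j)) ^ v j)
        = (if v = v0 then of_nat (N ^ Suc k) else 0)"
    proof (cases "v = v0")
      case True
      then show ?thesis unfolding sum_eq by (simp add: v0_def)
    next
      case False
      have "\<exists>j<m. v j \<noteq> 0"
      proof (rule ccontr)
        assume "\<not> (\<exists>j<m. v j \<noteq> 0)"
        then have "v = v0"
          using v by (intro extensionalityI[of _ "{..<m}"]) (auto simp: V_def v0_def PiE_iff)
        with False show False ..
      qed
      then obtain j where j: "j < m" "v j \<noteq> 0" by blast
      \<comment> \<open>The entries of \<open>v\<close> are least residues, so a nonzero entry is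
        not divisible by \<open>N\<close>.\<close>
      have "v j < N" using v j(1) by (auto simp: V_def PiE_iff)
      then have "\<not> N dvd v j" using j(2) by (auto dest: dvd_imp_le)
      with j(1) ker[of v j] have "\<not> N dvd (\<Sum>j<m. v j) \<or> (\<exists>i<k. \<not> N dvd (\<Sum>j<m. D i j * v j))"
        by blast
      then show ?thesis unfolding sum_eq using False by (auto intro!: prod_zero)
    qed
  qed
  also have "\<dots> = of_nat (N ^ Suc k)"
    using N finV by (simp add: sum.delta V_def v0_def)
  finally have "card ?S * N ^ m = N ^ Suc k"
    by (simp only: of_nat_eq_iff)
  then show ?thesis by (simp only: P_def M_def)
qed

text \<open>Scaling all monomials by \<open>t\<close> does not affect whether the sum vanishes, so
  the pairs of a nonzero \<open>t\<close> and a root \<open>x\<close> are the disjoint union of the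
  fibres over the solutions \<open>y\<close> of the linear equation. All these fibres have the same
  size; one factor \<open>N\<close> cancels against the choice of \<open>t\<close>. The powers of
  \<open>N\<close> stay on both sides to avoid division.\<close>

lemma card_torus_roots:
  fixes D :: "nat \<Rightarrow> nat \<Rightarrow> nat" and a :: "nat \<Rightarrow> 'a::{finite,field}" and k m :: nat
  defines "N \<equiv> CARD('a) - 1"
  assumes ker: "\<And>v j. \<lbrakk>N dvd (\<Sum>j<m. v j); \<And>i. i < k \<Longrightarrow> N dvd (\<Sum>j<m. D i j * v j); j < m\<rbrakk>
      \<Longrightarrow> N dvd v j"
  shows "card {x \<in> {..<k} \<rightarrow>\<^sub>E - {0}. (\<Sum>j<m. a j * (\<Prod>i<k. x i ^ D i j)) = 0} * N ^ m
    = N ^ k * card {y \<in> {..<m} \<rightarrow>\<^sub>E - {0}. (\<Sum>j<m. a j * y j) = 0}"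
    (is "card ?L * _ = _ * card ?Y")
proof -
  define fib where "fib = (\<lambda>y. {(t, x). t \<noteq> 0 \<and> x \<in> {..<k} \<rightarrow>\<^sub>E - {0} \<and>
      (\<forall>j<m. t * (\<Prod>i<k. x i ^ D i j) = (y j :: 'a))})"
  have N: "N > 0"
    using card_mono[of UNIV "{0, 1::'a}"] by (simp add: N_def)
  have fin: "finite ({..<k} \<rightarrow>\<^sub>E - {0::'a})" "finite ?Y" "finite (fib y)" for y
  proof -
    show P: "finite ({..<k} \<rightarrow>\<^sub>E - {0::'a})" by (intro finite_PiE) auto
    show "finite ?Y" by (intro finite_subset[OF _ finite_PiE[of "{..<m}" "\<lambda>_. - {0}"]]) auto
    have "fib y \<subseteq> UNIV \<times> ({..<k} \<rightarrow>\<^sub>E - {0})" by (auto simp: fib_def)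
    then show "finite (fib y)" by (rule finite_subset) (simp add: P)
  qed
  have fibre: "card (fib y) * N ^ m = N ^ Suc k" if "y \<in> ?Y" for y
    unfolding fib_def N_def
  proof (rule card_monomial_fibre)
    fix v j
    assume "CARD('a) - 1 dvd (\<Sum>j<m. v j)" "\<And>i. i < k \<Longrightarrow> CARD('a) - 1 dvd (\<Sum>j<m. D i j * v j)" "j < m"
    then show "CARD('a) - 1 dvd v j" by (rule ker[unfolded N_def])
  qed (use that in simp)
  have scale: "(\<Sum>j<m. a j * (t * (\<Prod>i<k. x i ^ D i j))) = t * (\<Sum>j<m. a j * (\<Prod>i<k. x i ^ D i j))"
    for t x by (simp add: sum_distrib_left mult_ac)
  have "(- {0::'a}) \<times> ?L = (\<Union>y\<in>?Y. fib y)"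
  proof (intro equalityI subsetI)
    fix p assume "p \<in> (- {0::'a}) \<times> ?L"
    then obtain t x where p: "p = (t, x)" "t \<noteq> 0" "x \<in> ?L" by auto
    define y where "y = (\<lambda>j\<in>{..<m}. t * (\<Prod>i<k. x i ^ D i j))"
    have "y \<in> ?Y" using p scale[of t x] by (auto simp: y_def PiE_iff)
    moreover have "p \<in> fib y" using p by (auto simp: fib_def y_def)
    ultimately show "p \<in> (\<Union>y\<in>?Y. fib y)" by blast
  next
    fix p assume "p \<in> (\<Union>y\<in>?Y. fib y)"
    then obtain t x y where p: "p = (t, x)" "y \<in> ?Y" "t \<noteq> 0" "x \<in> {..<k} \<rightarrow>\<^sub>E - {0}"
      "\<And>j. j < m \<Longrightarrow> t * (\<Prod>i<k. x i ^ D i j) = y j"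
      by (auto simp: fib_def)
    have "t * (\<Sum>j<m. a j * (\<Prod>i<k. x i ^ D i j)) = (\<Sum>j<m. a j * y j)"
      unfolding scale[symmetric] using p(5) by (intro sum.cong) auto
    then show "p \<in> (- {0::'a}) \<times> ?L" using p by simp
  qed
  moreover have "fib y \<inter> fib y' = {}" if "y \<in> ?Y" "y' \<in> ?Y" "y \<noteq> y'" for y y'
  proof (rule ccontr)
    assume "fib y \<inter> fib y' \<noteq> {}"
    then have "\<forall>j<m. y j = y' j" by (auto simp: fib_def)
    then have "y = y'"
      using that by (intro PiE_ext[of y "{..<m}" "\<lambda>_. - {0}" y']) auto
    with that show False by simp
  qed
  ultimately have "card ((- {0::'a}) \<times> ?L) = (\<Sum>y\<in>?Y. card (fib y))"
    using fin by (simp add: card_UN_disjoint)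
  then have "N * (card ?L * N ^ m) = (\<Sum>y\<in>?Y. card (fib y)) * N ^ m"
    by (simp add: card_cartesian_product N_def Compl_eq_Diff_UNIV)
  also have "\<dots> = (\<Sum>y\<in>?Y. N ^ Suc k)"
    using fibre by (simp only: sum_distrib_right cong: sum.cong)
  finally show ?thesis using N by (simp add: mult_ac)
qed

section \<open>Linear equations with nonzero unknowns\<close>

text \<open>Given the first \<open>m\<close> unknowns, the equation determines the last one, and
  this value is nonzero exactly when the partial sum is nonzero. Solutions in \<open>m + 1\<close>
  unknowns thus correspond to non-solutions in \<open>m\<close> unknowns.\<close>

lemma card_linear_torus_Suc:
  fixes a :: "nat \<Rightarrow> 'a::{finite,field}"
  assumes "a m \<noteq> 0"
  shows "card {y \<in> {..<Suc m} \<rightarrow>\<^sub>E - {0}. (\<Sum>j<Suc m. a j * y j) = 0}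
      + card {y \<in> {..<m} \<rightarrow>\<^sub>E - {0}. (\<Sum>j<m. a j * y j) = 0} = (CARD('a) - 1) ^ m"
    (is "card ?Y1 + card ?Y = _")
proof -
  let ?Z = "{y \<in> {..<m} \<rightarrow>\<^sub>E - {0}. (\<Sum>j<m. a j * y j) \<noteq> 0}"
  \<comment> \<open>The inverse resets coordinate \<open>m\<close> to \<open>undefined\<close>, the
    value required of extensional functions on \<open>{..<m}\<close>.\<close>
  have "bij_betw (\<lambda>y. y(m := - (\<Sum>j<m. a j * y j) / a m)) ?Z ?Y1"
  proof (rule bij_betw_byWitness[where f' = "\<lambda>y. y(m := undefined)"])
    show "\<forall>y\<in>?Z. (y(m := - (\<Sum>j<m. a j * y j) / a m)) (m := undefined) = y"
      by (auto simp: PiE_iff extensional_def fun_eq_iff)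
    show "\<forall>y\<in>?Y1. (y(m := undefined)) (m := - (\<Sum>j<m. a j * (y(m := undefined)) j) / a m) = y"
      using assms by (auto simp: fun_eq_iff divide_eq_eq add_eq_0_iff2 mult_ac)
    show "(\<lambda>y. y(m := - (\<Sum>j<m. a j * y j) / a m)) ` ?Z \<subseteq> ?Y1"
      using assms by (auto simp: PiE_iff extensional_def less_Suc_eq)
    show "(\<lambda>y. y(m := undefined)) ` ?Y1 \<subseteq> ?Z"
    proof clarify
      fix y assume y: "y \<in> {..<Suc m} \<rightarrow>\<^sub>E - {0}" "(\<Sum>j<Suc m. a j * y j) = 0"
      have "a m * y m \<noteq> 0" using assms y(1) by (auto simp: PiE_iff)
      then have "(\<Sum>j<m. a j * y j) \<noteq> 0" using y(2) by auto
      then show "y(m := undefined) \<in> {..<m} \<rightarrow>\<^sub>E - {0} \<and> (\<Sum>j<m. a j * (y(m := undefined)) j) \<noteq> 0"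
        using y(1) by (auto simp: PiE_iff extensional_def)
    qed
  qed
  then have "card ?Y1 = card ?Z" by (simp add: bij_betw_same_card)
  moreover have "finite ({..<m} \<rightarrow>\<^sub>E - {0::'a})" by (intro finite_PiE) auto
  then have "card ?Z + card ?Y = card (?Z \<union> ?Y)"
    by (intro card_Un_disjoint[symmetric]) auto
  moreover have "?Z \<union> ?Y = {..<m} \<rightarrow>\<^sub>E - {0}" by auto
  ultimately show ?thesis
    by (simp add: card_PiE Compl_eq_Diff_UNIV)
qed

text \<open>The preceding recursion is solved by induction, starting from the single empty solution
  for \<open>m = 0\<close>.\<close>

lemma card_linear_torus:
  fixes a :: "nat \<Rightarrow> 'a::{finite,field}"
  assumes "\<And>j. j < m \<Longrightarrow> a j \<noteq> 0"
  shows "real CARD('a) * real (card {y \<in> {..<m} \<rightarrow>\<^sub>E - {0}. (\<Sum>j<m. a j * y j) = 0})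
    = (real CARD('a) - 1) ^ m + (-1) ^ m * (real CARD('a) - 1)"
  using assms
proof (induction m)
  case 0
  then show ?case by (simp add: PiE_empty_domain)
next
  case (Suc m)
  let ?c = "\<lambda>m. real (card {y \<in> {..<m} \<rightarrow>\<^sub>E - {0}. (\<Sum>j<m. a j * y j) = 0})"
  have "real (CARD('a) - 1) = real CARD('a) - 1"
    using zero_less_card_finite[where 'a = 'a] by linarith
  then have "?c (Suc m) = (real CARD('a) - 1) ^ m - ?c m"
    using arg_cong[OF card_linear_torus_Suc[of a m], of real] Suc.prems
    by (simp only: of_nat_add of_nat_power) (simp add: algebra_simps)
  moreover have "real CARD('a) * ?c m = (real CARD('a) - 1) ^ m + (-1) ^ m * (real CARD('a) - 1)"
    using Suc by simp
  ultimately show ?case by (simp only: right_diff_distrib power_Suc) (simp add: algebra_simps)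
qed

section \<open>Congruence systems of triangular and linear polynomials\<close>

text \<open>Row 0 of the matrix is the row of ones, and row \<open>i + 1\<close> holds the exponents
  of the variable with index \<open>i\<close>. The result has the shape of the kernel condition in
  \<open>card_monomial_fibre\<close>.\<close>

lemma mem_cong_solutions_aug_degree_mat:
  fixes v :: "nat \<Rightarrow> nat"
  assumes "\<And>j. j < length f \<Longrightarrow> dim_vec (snd (f ! j)) = k"
  shows "vec (length f) (\<lambda>j. int (v j)) \<in> cong_solutions (int N) (aug_degree_mat k f) \<longleftrightarrow>
    N dvd (\<Sum>j<length f. v j) \<and> (\<forall>i<k. N dvd (\<Sum>j<length f. (snd (f ! j) $ i) * v j))"
proof -
  let ?A = "aug_degree_mat k f" and ?w = "vec (length f) (\<lambda>j. int (v j))"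
  have dims: "dim_row ?A = Suc k" "dim_col ?A = length f"
    by (simp_all add: aug_degree_mat_def)
  have ent: "?A $$ (i, j) = (if i = 0 then 1 else int (snd (f ! j) $ (i - 1)))"
    if "i < Suc k" "j < length f" for i j
    using that assms[of j]
    by (auto simp: aug_degree_mat_def mat_of_cols_def case_prod_beta vec_index_vCons)
  have row: "(?A *\<^sub>v ?w) $ i
      = int (\<Sum>j<length f. (if i = 0 then 1 else snd (f ! j) $ (i - 1)) * v j)"
    if "i < Suc k" for i
    using that by (cases i) (simp_all add: mult_mat_vec_def scalar_prod_def dims ent atLeast0LessThan)
  have "?w \<in> cong_solutions (int N) ?A \<longleftrightarrow>
      (\<forall>i<Suc k. N dvd (\<Sum>j<length f. (if i = 0 then 1 else snd (f ! j) $ (i - 1)) * v j))"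
    by (simp add: cong_solutions_def dims row cong_0_iff del: of_nat_sum index_mult_mat_vec)
  also have "\<dots> \<longleftrightarrow> N dvd (\<Sum>j<length f. v j) \<and> (\<forall>i<k. N dvd (\<Sum>j<length f. (snd (f ! j) $ i) * v j))"
    by (simp add: All_less_Suc2)
  finally show ?thesis .
qed

lemma length_triangular_poly: "length (triangular_poly n a d b) = (if b = 0 then n else Suc n)"
  by (simp add: triangular_poly_def minus_const_def)

lemma length_linear_poly: "length (linear_poly n a b) = (if b = 0 then n else Suc n)"
  by (simp add: linear_poly_def minus_const_def)

text \<open>The guard \<open>j < n\<close> covers the constant term, which for
  \<open>b \<noteq> 0\<close> has index \<open>n\<close> and exponent vector 0.\<close>

lemma snd_triangular_poly:
  assumes "j < length (triangular_poly n a d b)"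
  shows "snd (triangular_poly n a d b ! j) = vec n (\<lambda>i. if i \<le> j \<and> j < n then d i j else 0)"
  using assms by (auto simp: triangular_poly_def minus_const_def nth_append split: if_splits)

lemma snd_linear_poly:
  assumes "j < length (linear_poly n a b)"
  shows "snd (linear_poly n a b ! j) = vec n (\<lambda>i. if j = i then 1 else 0)"
  using assms by (auto simp: linear_poly_def minus_const_def nth_append split: if_splits)

text \<open>The system of the linear polynomial has only the trivial solution modulo
  \<open>q - 1\<close>: the row of each variable isolates one entry of \<open>v\<close>.
  Star-equivalence transfers this to the triangular polynomial.\<close>

lemma star_equiv_linear_kernel:
  fixes a :: "nat \<Rightarrow> 'a::{finite,field}" and v :: "nat \<Rightarrow> nat"
  assumes "star_equiv k (triangular_poly k a d b) (linear_poly k a b)"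
    and m: "m = (if b = 0 then k else Suc k)"
    and sum: "CARD('a) - 1 dvd (\<Sum>j<m. v j)"
    and rows: "\<And>i. i < k \<Longrightarrow>
      CARD('a) - 1 dvd (\<Sum>j<m. (if i \<le> j \<and> j < k then d i j else 0) * v j)"
    and "j < m"
  shows "CARD('a) - 1 dvd v j"
proof -
  let ?N = "CARD('a) - 1" and ?f = "triangular_poly k a d b" and ?g = "linear_poly k a b"
  have len: "length ?f = m" "length ?g = m"
    using m by (simp_all add: length_triangular_poly length_linear_poly)
  have N: "int CARD('a) - 1 = int ?N"
    using zero_less_card_finite[where 'a = 'a] by linarith
  have "vec m (\<lambda>j. int (v j)) \<in> cong_solutions (int ?N) (aug_degree_mat k ?f)"
    using mem_cong_solutions_aug_degree_mat[of ?f k v ?N] sum rows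
    by (simp add: len snd_triangular_poly)
  then have "vec m (\<lambda>j. int (v j)) \<in> cong_solutions (int ?N) (aug_degree_mat k ?g)"
    using assms(1) unfolding star_equiv_def N by blast
  then have "\<forall>i<k. ?N dvd (\<Sum>j<m. (if j = i then 1 else 0) * v j)"
    using mem_cong_solutions_aug_degree_mat[of ?g k v ?N]
    by (simp add: len snd_linear_poly)
  then have "?N dvd (\<Sum>j<m. if j = i then v j else 0)" if "i < k" for i
    using that by (simp add: if_distrib[of "\<lambda>c. c * _"] cong: if_cong)
  then have diag: "?N dvd v i" if "i < k" for i
    using that m by (auto simp: sum.delta split: if_splits)
  show ?thesis
  proof (cases "j < k")
    \<comment> \<open>The entry of the constant term occurs only in the row of ones, where all other
      entries are already known to be 0 modulo \<open>q - 1\<close>.\<close>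
    case False
    with \<open>j < m\<close> m have "m = Suc k" "j = k" by (auto split: if_splits)
    moreover have "?N dvd (\<Sum>j<k. v j)" using diag by (intro dvd_sum) auto
    ultimately show ?thesis using sum by (simp add: dvd_add_right_iff)
  qed (rule diag)
qed

section \<open>Restriction to the first variables\<close>

text \<open>Terms with index below \<open>k\<close> involve only the first \<open>k\<close>
  variables, while a later term with index \<open>j\<close> contains its own variable
  \<open>j\<close> and disappears. The constant term always survives. Keeping \<open>D\<close>
  general serves the triangular and the linear polynomial alike.\<close>

lemma restrict_vars_minus_const:
  assumes "k \<le> n" and dim: "\<And>j. j < n \<Longrightarrow> dim_vec (D j) = n"
    and keep: "\<And>i j. j < k \<Longrightarrow> k \<le> i \<Longrightarrow> i < n \<Longrightarrow> D j $ i = 0"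
    and kill: "\<And>j. k \<le> j \<Longrightarrow> j < n \<Longrightarrow> D j $ j \<noteq> 0"
  shows "restrict_vars k (minus_const n (map (\<lambda>j. (a j, D j)) [0..<n]) b)
    = minus_const k (map (\<lambda>j. (a j, vec_first (D j) k)) [0..<k]) b"
proof -
  have append: "restrict_vars k (f @ g) = restrict_vars k f @ restrict_vars k g" for f g :: "'a terms"
    by (simp add: restrict_vars_def)
  have upt: "[0..<n] = [0..<k] @ [k..<n]"
    using assms(1) by (metis le_add_diff_inverse upt_add_eq_append zero_le)
  have keep_map: "restrict_vars k (map (\<lambda>j. (a j, D j)) js) = map (\<lambda>j. (a j, vec_first (D j) k)) js"
    if "set js \<subseteq> {..<k}" for js
    using that assms(1) keep dim by (induction js) (auto simp: restrict_vars_def)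
  have kill_map: "restrict_vars k (map (\<lambda>j. (a j, D j)) js) = []" if "set js \<subseteq> {k..<n}" for js
    using that kill dim by (induction js) (auto simp: restrict_vars_def)
  have "vec_first (0\<^sub>v n) k = (0\<^sub>v k :: nat vec)"
    using assms(1) by (auto simp: vec_first_def)
  then have const: "restrict_vars k [(- b, 0\<^sub>v n)] = [(- b, 0\<^sub>v k)]"
    by (simp add: restrict_vars_def)
  show ?thesis
    by (simp add: minus_const_def upt append const keep_map[of "[0..<k]"] kill_map[of "[k..<n]"]
        restrict_vars_def[of k "[]"] atLeast0LessThan)
qed

lemma restrict_vars_triangular_poly:
  assumes "k \<le> n" "\<And>j. j < n \<Longrightarrow> d j j > 0"
  shows "restrict_vars k (triangular_poly n a d b) = triangular_poly k a d b"
proof -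
  have "vec_first (vec n h) k = vec k h" for h :: "nat \<Rightarrow> nat"
    using assms(1) by (auto simp: vec_first_def)
  then show ?thesis
    unfolding triangular_poly_def using assms by (subst restrict_vars_minus_const) auto
qed

lemma restrict_vars_linear_poly:
  assumes "k \<le> n"
  shows "restrict_vars k (linear_poly n a b) = linear_poly k a b"
proof -
  have "vec_first (unit_vec n j) k = (unit_vec k j :: nat vec)" for j
    using assms by (auto simp: vec_first_def unit_vec_def)
  then show ?thesis
    unfolding linear_poly_def using assms by (subst restrict_vars_minus_const) auto
qed

section \<open>Triangular polynomials as functions\<close>

text \<open>Points are functions on indices rather than vectors, so that points for different
  \<open>k\<close> are related by function update and can be counted in extensional function
  spaces.\<close>

definition triangular_value ::
  "nat \<Rightarrow> (nat \<Rightarrow> 'a::field) \<Rightarrow> (nat \<Rightarrow> nat \<Rightarrow> nat) \<Rightarrow> 'a \<Rightarrow> (nat \<Rightarrow> 'a) \<Rightarrow> 'a" where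
  "triangular_value k a d b x = (\<Sum>j<k. a j * (\<Prod>i\<le>j. x i ^ d i j)) - b"

lemma eval_triangular_poly:
  "eval_terms (triangular_poly n a d b) (vec n x) = triangular_value n a d b x"
proof -
  have "(\<Prod>i<n. vec n x $ i ^ (vec n (\<lambda>i. if i \<le> j then d i j else 0) $ i))
      = (\<Prod>i\<le>j. x i ^ d i j)" if "j < n" for j
    using that by (intro prod.mono_neutral_cong_right) auto
  then show ?thesis
    by (auto simp: eval_terms_def triangular_poly_def minus_const_def triangular_value_def
        o_def interv_sum_list_conv_sum_set_nat atLeast0LessThan intro!: sum.cong)
qed

lemma card_roots_in_triangular_poly:
  fixes a :: "nat \<Rightarrow> 'a::{finite,field}"
  shows "card (roots_in n (triangular_poly n a d b))
    = card {x \<in> {..<n} \<rightarrow>\<^sub>E UNIV. triangular_value n a d b x = 0}"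
proof -
  have "bij_betw (vec n) {x \<in> {..<n} \<rightarrow>\<^sub>E UNIV. triangular_value n a d b x = 0}
      (roots_in n (triangular_poly n a d b))"
    unfolding bij_betw_def
  proof (intro conjI inj_onI equalityI subsetI)
    fix x y :: "nat \<Rightarrow> 'a"
    assume xy: "x \<in> {x \<in> {..<n} \<rightarrow>\<^sub>E UNIV. triangular_value n a d b x = 0}"
      "y \<in> {x \<in> {..<n} \<rightarrow>\<^sub>E UNIV. triangular_value n a d b x = 0}" and "vec n x = vec n y"
    then have "x i = y i" if "i < n" for i using that by (metis index_vec)
    then show "x = y" using xy by (intro PiE_ext[of x "{..<n}" "\<lambda>_. UNIV" y]) auto
  next
    fix v assume v: "v \<in> roots_in n (triangular_poly n a d b)"
    have "v = vec n (\<lambda>i\<in>{..<n}. v $ i)"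
      using v by (intro eq_vecI) (auto simp: roots_in_def)
    with v show "v \<in> vec n ` {x \<in> {..<n} \<rightarrow>\<^sub>E UNIV. triangular_value n a d b x = 0}"
      by (intro image_eqI[of _ _ "\<lambda>i\<in>{..<n}. v $ i"])
        (auto simp: roots_in_def simp flip: eval_triangular_poly)
  next
    fix v assume "v \<in> vec n ` {x \<in> {..<n} \<rightarrow>\<^sub>E UNIV. triangular_value n a d b x = 0}"
    then obtain x where "v = vec n x" "triangular_value n a d b x = 0" by blast
    then show "v \<in> roots_in n (triangular_poly n a d b)"
      by (simp add: roots_in_def eval_triangular_poly)
  qed
  then show ?thesis by (simp add: bij_betw_same_card)
qed

lemma triangular_value_cong:
  assumes "\<And>i. i < k \<Longrightarrow> x i = y i"
  shows "triangular_value k a d b x = triangular_value k a d b y"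
  using assms by (simp add: triangular_value_def)

section \<open>Roots with and without zero coordinates, and their total number\<close>

text \<open>Since every variable up to \<open>k\<close> occurs in the last term, a zero among them
  kills it, and the value no longer depends on \<open>x k\<close>. If a zero lies among the first
  \<open>k\<close> coordinates, \<open>x k\<close> is free; otherwise \<open>x k\<close> itself must
  be 0.\<close>

lemma card_degenerate_roots_Suc:
  fixes a :: "nat \<Rightarrow> 'a::{finite,field}"
  assumes d: "\<And>i. i \<le> k \<Longrightarrow> d i k > 0"
  shows "card {x \<in> {..<Suc k} \<rightarrow>\<^sub>E UNIV. (\<exists>i<Suc k. x i = 0) \<and> triangular_value (Suc k) a d b x = 0}
    = CARD('a) * card {x \<in> {..<k} \<rightarrow>\<^sub>E UNIV. (\<exists>i<k. x i = 0) \<and> triangular_value k a d b x = 0}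
      + card {x \<in> {..<k} \<rightarrow>\<^sub>E - {0}. triangular_value k a d b x = 0}"
    (is "card ?P1 = _ * card ?P + card ?L")
proof -
  let ?h = "\<lambda>(c, x :: nat \<Rightarrow> 'a). x(k := c)"
  let ?E = "{..<k} \<rightarrow>\<^sub>E (UNIV :: 'a set)"
  \<comment> \<open>Pairs of the last coordinate and the preceding point, split according to where
    the zero lies.\<close>
  let ?T = "(UNIV :: 'a set) \<times> ?P \<union> {0} \<times> ?L"
  have val: "triangular_value (Suc k) a d b x = triangular_value k a d b x"
    if "\<exists>i\<le>k. x i = 0" for x
  proof -
    have "(\<Prod>i\<le>k. x i ^ d i k) = 0"
      using that d by (force intro!: prod_zero)
    then show ?thesis by (simp add: triangular_value_def)
  qed
  have valk: "triangular_value k a d b (x(k := c)) = triangular_value k a d b x" for x c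
    by (rule triangular_value_cong) simp
  have E: "finite ?E" by (intro finite_PiE) auto
  have sub: "?T \<subseteq> UNIV \<times> ?E" by (auto simp: PiE_iff extensional_def)
  then have "finite ?T" by (rule finite_subset) (simp add: E)
  have "?P1 = ?h ` ?T"
  proof (intro equalityI subsetI)
    fix y assume y: "y \<in> ?P1"
    define x where "x = y(k := undefined)"
    have yx: "y = ?h (y k, x)" by (simp add: x_def)
    have xE: "x \<in> ?E" using y by (auto simp: x_def PiE_iff extensional_def)
    have "triangular_value k a d b y = 0" using y val[of y] by (auto simp: less_Suc_eq_le)
    then have x0: "triangular_value k a d b x = 0" by (simp add: x_def valk)
    have "(y k, x) \<in> ?T"
    proof (cases "\<exists>i<k. x i = 0")
      case False
      moreover have "y k = 0"
        using False y by (auto simp: x_def less_Suc_eq)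
      ultimately show ?thesis using xE x0 by (auto simp: PiE_iff)
    qed (use xE x0 in auto)
    then show "y \<in> ?h ` ?T" using yx by blast
  next
    fix y assume "y \<in> ?h ` ?T"
    then obtain c x where y: "y = x(k := c)" and cx: "(c, x) \<in> ?T" by auto
    have "\<exists>i\<le>k. y i = 0" using cx by (auto simp: y)
    moreover have "triangular_value k a d b y = 0" using cx by (auto simp: y valk)
    moreover have "y \<in> {..<Suc k} \<rightarrow>\<^sub>E UNIV"
      using cx by (auto simp: y PiE_iff extensional_def)
    ultimately show "y \<in> ?P1" using val[of y] by (auto simp: less_Suc_eq_le)
  qed
  moreover have "inj_on ?h ?T"
    by (rule inj_on_subset[OF inj_combinator sub]) simp
  ultimately have "card ?P1 = card ?T" by (simp add: card_image)
  also have "\<dots> = card ((UNIV :: 'a set) \<times> ?P) + card ({0::'a} \<times> ?L)"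
    using \<open>finite ?T\<close> by (intro card_Un_disjoint) (auto simp: PiE_iff)
  finally show ?thesis by (simp add: card_cartesian_product)
qed

text \<open>Star-equivalence provides the trivial kernel that reduces the count to a linear equation
  in as many unknowns as there are terms. Equivalence is demanded only for \<open>k > 0\<close>; the
  case \<open>k = 0\<close> serves as the start of the later recursion.\<close>

lemma card_torus_roots_triangular:
  fixes a :: "nat \<Rightarrow> 'a::{finite,field}"
  assumes a: "\<And>j. j < k \<Longrightarrow> a j \<noteq> 0"
    and equiv: "k > 0 \<Longrightarrow> star_equiv k (triangular_poly k a d b) (linear_poly k a b)"
  shows "real CARD('a) * real (card {x \<in> {..<k} \<rightarrow>\<^sub>E - {0}. triangular_value k a d b x = 0})
    = (if b = 0 then (real CARD('a) - 1) ^ k + (-1) ^ k * (real CARD('a) - 1)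
       else (real CARD('a) - 1) ^ k - (-1) ^ k)"
proof (cases "k = 0")
  case True
  then show ?thesis by (simp add: triangular_value_def PiE_empty_domain)
next
  case False
  define N where "N = CARD('a) - 1"
  define m where "m = (if b = 0 then k else Suc k)"
  define D where "D = (\<lambda>i j. if i \<le> j \<and> j < k then d i j else 0)"
  \<comment> \<open>For \<open>b \<noteq> 0\<close> the constant \<open>- b\<close> is the term with index \<open>k\<close> and exponent vector 0.\<close>
  define a' where "a' = a(k := - b)"
  have N: "N > 0" "real N = real CARD('a) - 1"
    using card_mono[of UNIV "{0, 1::'a}"] by (simp_all add: N_def)
  have prod: "(\<Prod>i<k. x i ^ D i j) = (if j < k then \<Prod>i\<le>j. x i ^ d i j else 1)" for x :: "nat \<Rightarrow> 'a" and j
  proof (cases "j < k")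
    case True
    then show ?thesis
      by (simp, intro prod.mono_neutral_cong_right) (auto simp: D_def)
  qed (simp add: D_def)
  have val: "triangular_value k a d b x = (\<Sum>j<m. a' j * (\<Prod>i<k. x i ^ D i j))" for x
    by (simp add: triangular_value_def prod m_def a'_def)
  let ?L = "card {x \<in> {..<k} \<rightarrow>\<^sub>E - {0}. triangular_value k a d b x = 0}"
  let ?Y = "card {y \<in> {..<m} \<rightarrow>\<^sub>E - {0}. (\<Sum>j<m. a' j * y j) = 0}"
  have "?L * N ^ m = N ^ k * ?Y"
    unfolding val N_def
    by (rule card_torus_roots, rule star_equiv_linear_kernel[OF equiv])
      (use False in \<open>auto simp: m_def D_def\<close>)
  \<comment> \<open>After cancelling \<open>N ^ k\<close>, one factor \<open>N\<close> remains
    exactly when the constant term raises \<open>m\<close> to \<open>k + 1\<close>.\<close>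
  then have L: "(if b = 0 then ?L else ?L * N) = ?Y"
    using N(1) by (auto simp: m_def)
  have "a' j \<noteq> 0" if "j < m" for j
    using that a by (auto simp: a'_def m_def split: if_splits)
  then have Y: "real CARD('a) * real ?Y = real N ^ m + (-1) ^ m * real N"
    using card_linear_torus[of m a'] N(2) by simp
  show ?thesis
  proof (cases "b = 0")
    case True
    then show ?thesis using L Y N(2) by (simp add: m_def)
  next
    case False
    then have "real N * (real CARD('a) * real ?L) = real N * (real N ^ k - (-1) ^ k)"
      using Y L[symmetric] by (simp add: m_def algebra_simps)
    then show ?thesis using False N by simp
  qed
qed

theorem theorem12:
  fixes a :: "nat \<Rightarrow> 'a::{finite,field}" and b :: 'a
    and d :: "nat \<Rightarrow> nat \<Rightarrow> nat" and n q :: nat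
  assumes "q = CARD('a)"
    and "n \<ge> 1"
    and "\<forall>j<n. a j \<noteq> 0"
    and "\<forall>j<n. \<forall>i\<le>j. d i j > 0"
    and "totally_star_equiv n (triangular_poly n a d b) (linear_poly n a b)"
  shows "real (card (roots_in n (triangular_poly n a d b))) =
    (if b \<noteq> 0 then (real q ^ n - (-1) ^ n) / (real q + 1)
     else (2 * real q ^ n + (-1) ^ n * (real q - 1)) / (real q + 1))"
proof -
  define P where "P = (\<lambda>k. real (card {x \<in> {..<k} \<rightarrow>\<^sub>E UNIV.
      (\<exists>i<k. x i = 0) \<and> triangular_value k a d b x = 0}))"
  define L where "L = (\<lambda>k. real (card {x \<in> {..<k} \<rightarrow>\<^sub>E - {0}. triangular_value k a d b x = 0}))"
  have L: "real q * L k = (if b = 0 then (real q - 1) ^ k + (-1) ^ k * (real q - 1)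
       else (real q - 1) ^ k - (-1) ^ k)" if "k \<le> n" for k
    unfolding L_def assms(1)
  proof (rule card_torus_roots_triangular)
    \<comment> \<open>Restricting either polynomial to \<open>k\<close> variables yields the
      polynomial of the same kind in \<open>k\<close> variables.\<close>
    show "star_equiv k (triangular_poly k a d b) (linear_poly k a b)" if "k > 0"
      using assms(4,5) \<open>k \<le> n\<close> that unfolding totally_star_equiv_def
      by (metis Suc_leI One_nat_def le_refl restrict_vars_triangular_poly restrict_vars_linear_poly)
  qed (use assms(3) that in auto)
  have P_Suc: "P (Suc k) = real q * P k + L k" if "k < n" for k
    unfolding P_def L_def assms(1)
    by (subst card_degenerate_roots_Suc) (use assms(4) that in auto)
  have q: "real q > 0" using assms(1) by simp
  have *: "(real q + 1) * (P k + L k) = (if b = 0 then 2 * real q ^ k + (-1) ^ k * (real q - 1)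
       else real q ^ k - (-1) ^ k)" if "k \<le> n" for k
    using that
  proof (induction k)
    case 0
    have "P 0 = 0" by (simp add: P_def)
    moreover have "L 0 = (if b = 0 then 1 else 0)"
      by (simp add: L_def triangular_value_def PiE_empty_domain)
    ultimately show ?case by simp
  next
    case (Suc k)
    \<comment> \<open>The alternating terms of consecutive counts cancel, whether or not
      \<open>b = 0\<close>.\<close>
    have "real q * (L (Suc k) + L k) = real q * (real q - 1) ^ k"
      using L[of k] L[of "Suc k"] Suc.prems by (simp add: distrib_left) (simp add: algebra_simps)
    then have "L (Suc k) = (real q - 1) ^ k - L k" using q by simp
    then have "P (Suc k) + L (Suc k) = real q * (P k + L k) - real q * L k + (real q - 1) ^ k"
      using P_Suc[of k] Suc.prems by (simp add: algebra_simps)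
    \<comment> \<open>Arranged so that the induction hypothesis and the formula for
      \<open>real q * L k\<close> can be substituted; the powers of \<open>real q - 1\<close> then
      cancel.\<close>
    then have step: "(real q + 1) * (P (Suc k) + L (Suc k))
        = real q * ((real q + 1) * (P k + L k)) - (real q + 1) * (real q * L k - (real q - 1) ^ k)"
      by (simp add: algebra_simps)
    have "k \<le> n" using Suc.prems by simp
    show ?case
      unfolding step Suc.IH[OF \<open>k \<le> n\<close>] L[OF \<open>k \<le> n\<close>] by (auto simp: algebra_simps)
  qed
  have "{x \<in> {..<n} \<rightarrow>\<^sub>E UNIV. triangular_value n a d b x = 0}
      = {x \<in> {..<n} \<rightarrow>\<^sub>E UNIV. (\<exists>i<n. x i = 0) \<and> triangular_value n a d b x = 0}
        \<union> {x \<in> {..<n} \<rightarrow>\<^sub>E - {0}. triangular_value n a d b x = 0}" (is "?R = ?P \<union> ?L")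
    by (auto simp: PiE_iff)
  moreover have "finite ?R"
    by (rule finite_subset[OF _ finite_PiE[of "{..<n}" "\<lambda>_. UNIV"]]) auto
  ultimately have "card ?R = card ?P + card ?L"
    by (auto simp: PiE_iff intro!: card_Un_disjoint)
  then have "real (card (roots_in n (triangular_poly n a d b))) = P n + L n"
    by (simp add: card_roots_in_triangular_poly P_def L_def)
  moreover have "real q + 1 \<noteq> 0" by linarith
  ultimately show ?thesis
    using *[of n] by (simp add: field_simps)
qed

end
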